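(* Let $X$ be a finite set, let $\mathbb{F}$ be a field, and let $d\ge0$ be an integer. If $g:2^X\to\mathbb{F}$ is a nonzero null $d$-design, then $\mathrm{supp}(g)$ shatters a set of size at least $d+1$. In particular, $$\mathrm{VC}(g)\ge d+1.$$
   Context: $2^X$ is the family of all subsets of $X$. A function $g:2^X\to\mathbb{F}$ is a null $d$-design over $\mathbb{F}$ if $g$ is non-zero and $\sum_{F:\,A\subseteq F\subseteq X}g(F)=0$ for every $A\subseteq X$ with $|A|\le d$. $\mathrm{supp}(g):=\{F\subseteq X:g(F)\neq0\}$. A family $\mathcal{A}\subseteq2^X$ shatters $T\subseteq X$ if for every $B\subseteq T$ there is $A\in\mathcal{A}$ with $A\cap T=B$; $\mathrm{VC}(\mathcal{A})$ is the maximum size of a set shattered by $\mathcal{A}$, and $\mathrm{VC}(g):=\mathrm{VC}(\mathrm{supp}(g))$. *)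

theory Defs
  imports Main
begin

text \<open>
  A function on the power set of \<open>X\<close> is represented by a total function on
  \<^typ>\<open>'a set\<close>. Its values outside \<^term>\<open>Pow X\<close> are irrelevant, so every
  notion about such a function takes \<open>X\<close> as a parameter and refers only to
  subsets of \<open>X\<close>.
\<close>

definition null_design :: "'a set \<Rightarrow> nat \<Rightarrow> ('a set \<Rightarrow> 'f::field) \<Rightarrow> bool" where
  "null_design X d g \<longleftrightarrow>
     (\<exists>F. F \<subseteq> X \<and> g F \<noteq> 0) \<and>
     (\<forall>A. A \<subseteq> X \<and> card A \<le> d \<longrightarrow> (\<Sum>F | A \<subseteq> F \<and> F \<subseteq> X. g F) = 0)"

definition supp :: "'a set \<Rightarrow> ('a set \<Rightarrow> 'f::zero) \<Rightarrow> 'a set set" where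
  "supp X g = {F. F \<subseteq> X \<and> g F \<noteq> 0}"

definition shatters :: "'a set set \<Rightarrow> 'a set \<Rightarrow> bool" where
  "shatters \<A> T \<longleftrightarrow> (\<forall>B. B \<subseteq> T \<longrightarrow> (\<exists>A\<in>\<A>. A \<inter> T = B))"

text \<open>
  Meaningful for finite \<open>X\<close> and nonempty \<open>\<A>\<close>: a nonempty family shatters the
  empty set, so the maximum is over a finite nonempty set of numbers. For empty
  \<open>\<A>\<close> nothing is shattered and the value is unspecified.
\<close>

definition VC :: "'a set \<Rightarrow> 'a set set \<Rightarrow> nat" where
  "VC X \<A> = Max {card T | T. T \<subseteq> X \<and> shatters \<A> T}"

definition VC_fun :: "'a set \<Rightarrow> ('a set \<Rightarrow> 'f::zero) \<Rightarrow> nat" where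
  "VC_fun X g = VC X (supp X g)"

end

theory Submission
  imports Defs
begin

text \<open>
  The proof is by induction on the ground set. Splitting off a point \<open>x\<close> from \<open>insert x X\<close>
  turns \<open>g\<close> into two functions on the subsets of \<open>X\<close>: the trace sum
  \<open>h F = g F + g (insert x F)\<close>, and the link \<open>\<lambda>F. g (insert x F)\<close>. The vanishing sums of \<open>g\<close>
  over the sets \<open>A\<close> that avoid \<open>x\<close> are vanishing sums of \<open>h\<close> of the same order; those
  over the sets \<open>A\<close> that contain \<open>x\<close> are vanishing sums of the link of order one less.

  If \<open>h\<close> is nonzero somewhere, it has a large shattered set by induction, and this set is
  shattered by \<open>supp g\<close> too: where \<open>h F \<noteq> 0\<close>, one of \<open>F\<close> and \<open>insert x F\<close> lies in \<open>supp g\<close>,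
  and both have the same trace on a set that avoids \<open>x\<close>. If \<open>h\<close> is zero, then
  \<open>g F = - g (insert x F)\<close>, so \<open>F\<close> and \<open>insert x F\<close> always lie in \<open>supp g\<close> together. The link is then
  nonzero, and adding \<open>x\<close> to a set shattered by its support makes up for the order that was lost.
\<close>

lemma sum_supersets_containing_point:
  fixes g :: "'a set \<Rightarrow> 'b::comm_monoid_add"
  assumes "x \<notin> X" "A \<subseteq> X"
  shows "(\<Sum>F | insert x A \<subseteq> F \<and> F \<subseteq> insert x X. g F)
       = (\<Sum>F | A \<subseteq> F \<and> F \<subseteq> X. g (insert x F))"
proof (rule sum.reindex_bij_witness[where i = "insert x" and j = "\<lambda>F. F - {x}"])
qed (use assms in \<open>auto simp: insert_absorb\<close>)

lemma sum_supersets_avoiding_point: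
  fixes g :: "'a set \<Rightarrow> 'b::comm_monoid_add"
  assumes "finite X" "x \<notin> X" "A \<subseteq> X"
  shows "(\<Sum>F | A \<subseteq> F \<and> F \<subseteq> insert x X. g F)
       = (\<Sum>F | A \<subseteq> F \<and> F \<subseteq> X. g F + g (insert x F))"
proof -
  have split: "{F. A \<subseteq> F \<and> F \<subseteq> insert x X}
      = {F. A \<subseteq> F \<and> F \<subseteq> X} \<union> {F. insert x A \<subseteq> F \<and> F \<subseteq> insert x X}"
    using assms by auto
  have "(\<Sum>F | A \<subseteq> F \<and> F \<subseteq> insert x X. g F)
      = (\<Sum>F | A \<subseteq> F \<and> F \<subseteq> X. g F) + (\<Sum>F | insert x A \<subseteq> F \<and> F \<subseteq> insert x X. g F)"
    unfolding split by (rule sum.union_disjoint) (use assms in auto)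
  then show ?thesis
    by (simp only: sum_supersets_containing_point[OF assms(2,3)] sum.distrib)
qed

lemma shatters_mono_trace:
  assumes "shatters \<A> T" "\<And>A. A \<in> \<A> \<Longrightarrow> \<exists>B\<in>\<B>. B \<inter> T = A \<inter> T"
  shows "shatters \<B> T"
  using assms unfolding shatters_def by metis

lemma shatters_insert:
  assumes "shatters \<A> T" "x \<notin> T"
    and "\<And>A. A \<in> \<A> \<Longrightarrow> x \<notin> A \<and> A \<in> \<B> \<and> insert x A \<in> \<B>"
  shows "shatters \<B> (insert x T)"
  unfolding shatters_def
proof (intro allI impI)
  fix B assume "B \<subseteq> insert x T"
  then have "B - {x} \<subseteq> T" by auto
  then obtain A where A: "A \<in> \<A>" "A \<inter> T = B - {x}"
    using assms(1) unfolding shatters_def by blast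
  show "\<exists>C\<in>\<B>. C \<inter> insert x T = B"
  proof (cases "x \<in> B")
    case True
    then have "insert x A \<inter> insert x T = B" using A(2) by auto
    then show ?thesis using A(1) assms(3) by blast
  next
    case False
    then have "A \<inter> insert x T = B" using A assms(3) by auto
    then show ?thesis using A(1) assms(3) by blast
  qed
qed

text \<open>
  The order is counted by the strict bound \<open>card A < k\<close>, so that a null \<open>d\<close>-design is the case
  \<open>k = d + 1\<close>. Allowing \<open>k = 0\<close>, where no sum is required to vanish, lets the induction pass to the
  link without treating \<open>d = 0\<close> separately.
\<close>

lemma vanishing_sums_imp_shatters:
  fixes g :: "'a set \<Rightarrow> 'b::ab_group_add"
  assumes "finite X" "\<exists>F\<subseteq>X. g F \<noteq> 0"
    and "\<And>A. A \<subseteq> X \<Longrightarrow> card A < k \<Longrightarrow> (\<Sum>F | A \<subseteq> F \<and> F \<subseteq> X. g F) = 0"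
  shows "\<exists>T\<subseteq>X. k \<le> card T \<and> shatters (supp X g) T"
  using assms
proof (induction X arbitrary: g k rule: finite_induct)
  case empty
  \<comment> \<open>The sum for \<open>A = {}\<close> has the single term \<open>g {} \<noteq> 0\<close>, which forces \<open>k = 0\<close>.\<close>
  have "{F::'a set. F = {}} = {{}}" by auto
  then have "k = 0"
    using empty(1) empty(2)[of "{}"] by (cases k) auto
  then show ?case
    using empty(1) by (auto simp: shatters_def supp_def)
next
  case (insert x X)
  define h where "h = (\<lambda>F. g F + g (insert x F))"
  show ?case
  proof (cases "\<exists>F\<subseteq>X. h F \<noteq> 0")
    case True
    have "(\<Sum>F | A \<subseteq> F \<and> F \<subseteq> X. h F) = 0" if "A \<subseteq> X" "card A < k" for A
      using insert.prems(2)[of A] that insert.hyps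
      by (auto simp: h_def sum_supersets_avoiding_point)
    then obtain T where T: "T \<subseteq> X" "k \<le> card T" "shatters (supp X h) T"
      using insert.IH[OF True] by blast
    have "shatters (supp (insert x X) g) T"
    proof (rule shatters_mono_trace[OF T(3)])
      fix F assume F: "F \<in> supp X h"
      then have "F \<in> supp (insert x X) g \<or> insert x F \<in> supp (insert x X) g"
        by (auto simp: supp_def h_def)
      moreover have "insert x F \<inter> T = F \<inter> T"
        using T(1) insert.hyps by auto
      ultimately show "\<exists>B\<in>supp (insert x X) g. B \<inter> T = F \<inter> T" by blast
    qed
    then show ?thesis using T by blast
  next
    case False
    define l where "l = (\<lambda>F. g (insert x F))"
    have g_iff_l: "g F \<noteq> 0 \<longleftrightarrow> l F \<noteq> 0" if "F \<subseteq> X" for F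
      using False that by (auto simp: h_def l_def)
    obtain F where F: "F \<subseteq> insert x X" "g F \<noteq> 0" using insert.prems(1) by blast
    have "F - {x} \<subseteq> X" using F(1) by auto
    moreover have "l (F - {x}) \<noteq> 0"
    proof (cases "x \<in> F")
      case True
      then show ?thesis using F by (simp add: l_def insert_absorb)
    next
      case False
      then show ?thesis using F g_iff_l[of F] by auto
    qed
    ultimately have l_nonzero: "\<exists>F\<subseteq>X. l F \<noteq> 0" by blast
    have "(\<Sum>F | A \<subseteq> F \<and> F \<subseteq> X. l F) = 0" if A: "A \<subseteq> X" "card A < k - 1" for A
    proof -
      have "card (insert x A) < k"
        using A insert.hyps finite_subset[of A X] by (subst card_insert_disjoint) auto
      then show ?thesis
        using insert.prems(2)[of "insert x A"] A insert.hyps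
        by (auto simp: l_def simp flip: sum_supersets_containing_point)
    qed
    then obtain T where T: "T \<subseteq> X" "k - 1 \<le> card T" "shatters (supp X l) T"
      using insert.IH[OF l_nonzero] by blast
    have "x \<notin> T" using T(1) insert.hyps by auto
    have "shatters (supp (insert x X) g) (insert x T)"
    proof (rule shatters_insert[OF T(3) \<open>x \<notin> T\<close>])
      show "x \<notin> F \<and> F \<in> supp (insert x X) g \<and> insert x F \<in> supp (insert x X) g"
        if "F \<in> supp X l" for F
        using that g_iff_l[of F] insert.hyps by (auto simp: supp_def l_def)
    qed
    moreover have "k \<le> card (insert x T)"
      using T \<open>x \<notin> T\<close> finite_subset[OF T(1) insert.hyps(1)] by simp
    ultimately show ?thesis using T(1) by (intro exI[of _ "insert x T"]) auto
  qed
qed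

lemma card_le_VC:
  assumes "finite X" "T \<subseteq> X" "shatters \<A> T"
  shows "card T \<le> VC X \<A>"
proof -
  have "{card T |T. T \<subseteq> X \<and> shatters \<A> T} \<subseteq> card ` Pow X" by auto
  then have "finite {card T |T. T \<subseteq> X \<and> shatters \<A> T}"
    using assms(1) finite_subset by blast
  then show ?thesis unfolding VC_def using assms by (intro Max_ge) auto
qed

theorem corollary4p3:
  fixes X :: "'a set" and d :: nat and g :: "'a set \<Rightarrow> 'f::field"
  assumes "finite X"
    and "null_design X d g"
  shows "(\<exists>T. T \<subseteq> X \<and> card T \<ge> d + 1 \<and> shatters (supp X g) T) \<and> VC_fun X g \<ge> d + 1"
proof -
  have nonzero: "\<exists>F\<subseteq>X. g F \<noteq> 0"
    and vanishing: "\<And>A. A \<subseteq> X \<Longrightarrow> card A < d + 1 \<Longrightarrow> (\<Sum>F | A \<subseteq> F \<and> F \<subseteq> X. g F) = 0"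
    using assms(2) unfolding null_design_def by auto
  obtain T where T: "T \<subseteq> X" "d + 1 \<le> card T" "shatters (supp X g) T"
    using vanishing_sums_imp_shatters[OF assms(1) nonzero vanishing] by blast
  moreover have "card T \<le> VC_fun X g"
    unfolding VC_fun_def using card_le_VC[OF assms(1) T(1,3)] .
  ultimately show ?thesis by (meson order_trans)
qed

end
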